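(* Let $\mathcal U\subset\mathbb R^p$ be open with $[0,1]^p\subset\mathcal U$, let $\bar E(y,u)$, $u\in\mathcal U$, be the reduced energy, and fix $y$. For $T\subseteq[p]=\{1,\dots,p\}$ define $$\delta_T\bar E=\sum_{B\subseteq T}(-1)^{|T|-|B|}\,\bar E(y,\mathbf 1_B).$$ If $\bar E\in C^{|T|}$, then $$\delta_T\bar E=\int_{[0,1]^T}\partial_T^{|T|}\bar E(u_T,0_{T^c})\,\mathrm du_T .$$
   Context: The reduced energy is $\bar E(y,u)=\inf_\sigma E(y,\sigma,u)$, where $E(y,\sigma,u)=E_0(y,\sigma)+\sum_{i=1}^pu_i\Delta_i(y,\sigma)$ is an energy depending on a visible action $y$, hidden state $\sigma$ and mechanism amplitudes $u\in\mathcal U$. $\mathbf 1_B\in\{0,1\}^p$ is the indicator vector of $B\subseteq[p]$. $\partial_T^{|T|}=\prod_{i\in T}\partial_{u_i}$ is the mixed partial derivative taken once in each coordinate of $T$, and $(u_T,0_{T^c})$ is the vector with coordinates $u_i$ for $i\in T$ and $0$ otherwise; the argument $y$ is suppressed. *)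

theory Defs
  imports "HOL-Analysis.Analysis"
begin

definition energy ::
  "('y \<Rightarrow> 's \<Rightarrow> real) \<Rightarrow> ('p::finite \<Rightarrow> 'y \<Rightarrow> 's \<Rightarrow> real) \<Rightarrow> 'y \<Rightarrow> 's \<Rightarrow> real ^ 'p \<Rightarrow> real"
  where "energy E0 \<Delta> y \<sigma> u = E0 y \<sigma> + (\<Sum>i\<in>UNIV. u $ i * \<Delta> i y \<sigma>)"

(* A real infimum: it has its intended meaning only where the energy is bounded below in the
   hidden state. *)
definition reduced_energy ::
  "('y \<Rightarrow> 's \<Rightarrow> real) \<Rightarrow> ('p::finite \<Rightarrow> 'y \<Rightarrow> 's \<Rightarrow> real) \<Rightarrow> 'y \<Rightarrow> real ^ 'p \<Rightarrow> real"
  where "reduced_energy E0 \<Delta> y u = (INF \<sigma>. energy E0 \<Delta> y \<sigma> u)"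

definition indicator_vec :: "'p set \<Rightarrow> real ^ 'p::finite"
  where "indicator_vec B = (\<chi> i. if i \<in> B then 1 else 0)"

definition mixed_difference :: "'p set \<Rightarrow> (real ^ 'p::finite \<Rightarrow> real) \<Rightarrow> real"
  where "mixed_difference T F =
    (\<Sum>B\<in>Pow T. (-1) ^ (card T - card B) * F (indicator_vec B))"

definition partial_deriv :: "'p \<Rightarrow> (real ^ 'p::finite \<Rightarrow> real) \<Rightarrow> real ^ 'p \<Rightarrow> real"
  where "partial_deriv i f u = deriv (\<lambda>t. f (u + t *\<^sub>R axis i 1)) 0"

(* The list fixes the order of differentiation; its last entry is differentiated first. *)
primrec iterated_partial :: "'p list \<Rightarrow> (real ^ 'p::finite \<Rightarrow> real) \<Rightarrow> real ^ 'p \<Rightarrow> real"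
  where
    "iterated_partial [] f = f"
  | "iterated_partial (i # is) f = partial_deriv i (iterated_partial is f)"

(* Class C^k on an open set U: all partial derivatives of order at most k exist and are
   continuous on U. *)
primrec C_on :: "nat \<Rightarrow> (real ^ 'p::finite) set \<Rightarrow> (real ^ 'p \<Rightarrow> real) \<Rightarrow> bool"
  where
    "C_on 0 U f \<longleftrightarrow> continuous_on U f"
  | "C_on (Suc k) U f \<longleftrightarrow> continuous_on U f \<and>
      (\<forall>i. (\<forall>u\<in>U. (\<lambda>t. f (u + t *\<^sub>R axis i 1)) field_differentiable at 0) \<and>
           C_on k U (partial_deriv i f))"

definition extend_zero :: "'p set \<Rightarrow> ('p \<Rightarrow> real) \<Rightarrow> real ^ 'p::finite"
  where "extend_zero T w = (\<chi> i. if i \<in> T then w i else 0)"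

end

theory Submission
  imports Defs
begin

text \<open>
  The mixed difference is an iterated first difference: taking one coordinate \<open>i\<close> out of the index
  set turns the alternating sum over the vertices of a face of the unit cube into the difference of
  two such sums, over the faces at \<open>u\<^sub>i = 1\<close> and \<open>u\<^sub>i = 0\<close>
  (\<open>shifted_difference_insert\<close>). By induction each of these is an integral of the same lower-order
  partial derivative \<open>g\<close> over a parallel face, so their difference is the integral of an increment of
  \<open>g\<close> in direction \<open>i\<close>. The fundamental theorem of calculus rewrites the increment as an integral of
  \<open>\<partial>\<^sub>i g\<close> over \<open>[0,1]\<close> (\<open>integral_partial_deriv\<close>), and Fubini's theorem merges the two integrals
  into one over the face with \<open>i\<close> added (\<open>integral_face_insert\<close>). All integrands are continuous on
  the compact cube, which supplies the integrability.

  The face at \<open>u\<^sub>i = 1\<close> does not contain the origin, so the induction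
  (\<open>shifted_difference_eq_integral\<close>) is over faces through an arbitrary base point \<open>a\<close> of the cube
  whose coordinates vanish in the directions of the face.
\<close>

lemma C_on_imp_continuous: "C_on k U f \<Longrightarrow> continuous_on U f"
  by (cases k) auto

lemma C_on_SucD: "C_on (Suc k) U f \<Longrightarrow> C_on k U f"
proof (induction k arbitrary: f)
  case (Suc k)
  then show ?case by (metis C_on.simps(2))
qed simp

text \<open>Each derivative in the list consumes one order of smoothness. The spare order \<open>k\<close> is what the
  induction step and the fundamental theorem of calculus below draw on.\<close>

lemma C_on_iterated_partial:
  "C_on (length is + k) U f \<Longrightarrow> C_on k U (iterated_partial is f)"
proof (induction "is" arbitrary: k)
  case (Cons i "is")
  then have "C_on (Suc k) U (iterated_partial is f)" by (metis add_Suc_shift length_Cons)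
  then show ?case by simp
qed simp

text \<open>Partial derivatives are taken at parameter \<open>0\<close> of a line through the current point; the
  fundamental theorem needs the derivative at every parameter of one fixed line. The two differ by
  a translation of the parameter.\<close>

lemma has_partial_derivative_on_line:
  fixes b :: "real ^ 'p::finite"
  assumes "(\<lambda>t. f ((b + s *\<^sub>R axis i 1) + t *\<^sub>R axis i 1)) field_differentiable at 0"
  shows "((\<lambda>t. f (b + t *\<^sub>R axis i 1)) has_real_derivative
           partial_deriv i f (b + s *\<^sub>R axis i 1)) (at s)"
proof -
  have "((\<lambda>t. f ((b + s *\<^sub>R axis i 1) + t *\<^sub>R axis i 1)) has_real_derivative
          partial_deriv i f (b + s *\<^sub>R axis i 1)) (at 0)"
    using assms unfolding partial_deriv_def by (simp add: DERIV_deriv_iff_field_differentiable)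
  moreover have "(\<lambda>t. f ((b + s *\<^sub>R axis i 1) + t *\<^sub>R axis i 1)) =
      (\<lambda>t. f (b + (t + s) *\<^sub>R axis i 1))"
    by (simp add: algebra_simps)
  ultimately show ?thesis
    using DERIV_at_within_shift[of "\<lambda>t. f (b + t *\<^sub>R axis i 1)" _ s 0 UNIV]
    by (simp add: add.commute)
qed

lemma integral_partial_deriv:
  fixes U :: "(real ^ 'p::finite) set"
  assumes "open U" and "C_on (Suc 0) U f"
    and seg: "\<And>s. s \<in> {0..1} \<Longrightarrow> b + s *\<^sub>R axis i 1 \<in> U"
  shows "(LINT s : {0..1} | lborel. partial_deriv i f (b + s *\<^sub>R axis i 1)) =
    f (b + axis i 1) - f b"
proof -
  have "(LINT s|lborel. partial_deriv i f (b + s *\<^sub>R axis i 1) * indicator {0..1} s) =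
    f (b + 1 *\<^sub>R axis i 1) - f (b + 0 *\<^sub>R axis i 1)"
  proof (rule integral_FTC_Icc_real)
    fix s :: real assume s: "0 \<le> s" "s \<le> 1"
    then have mem: "b + s *\<^sub>R axis i 1 \<in> U" using seg by simp
    then show "((\<lambda>t. f (b + t *\<^sub>R axis i 1)) has_real_derivative
           partial_deriv i f (b + s *\<^sub>R axis i 1)) (at s)"
      using assms by (intro has_partial_derivative_on_line) simp
    have "isCont (partial_deriv i f) (b + s *\<^sub>R axis i 1)"
      using assms mem by (simp add: continuous_on_eq_continuous_at)
    then show "isCont (\<lambda>s. partial_deriv i f (b + s *\<^sub>R axis i 1)) s"
      by (rule isCont_o2[rotated]) (intro continuous_intros)
  qed simp
  then show ?thesis by (simp add: set_lebesgue_integral_def mult.commute)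
qed

text \<open>The mixed difference over the vertices of the face through \<open>a\<close>, rather than through the origin,
  spanned by the directions in \<open>S\<close>.\<close>

definition shifted_difference ::
  "real ^ 'p::finite \<Rightarrow> 'p set \<Rightarrow> (real ^ 'p \<Rightarrow> real) \<Rightarrow> real"
  where "shifted_difference a S F =
    (\<Sum>B\<in>Pow S. (-1) ^ (card S - card B) * F (a + indicator_vec B))"

text \<open>Subsets of \<open>insert i S\<close> split into those omitting \<open>i\<close>, whose signs flip because the ambient set
  grew by one, and those containing \<open>i\<close>, whose signs stay and whose vertices move by one unit in
  direction \<open>i\<close>.\<close>

lemma shifted_difference_insert:
  assumes "i \<notin> S"
  shows "shifted_difference a (insert i S) F =
    shifted_difference (a + axis i 1) S F - shifted_difference a S F"
proof -
  have fin: "finite S" by simp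
  have inj: "inj_on (insert i) (Pow S)" using assms by (auto simp: inj_on_def)
  have omitted: "(-1::real) ^ (card (insert i S) - card B) = - ((-1) ^ (card S - card B))"
    if "B \<in> Pow S" for B
    using that assms fin card_mono[of S B] by (simp add: Suc_diff_le)
  have inserted: "(-1::real) ^ (card (insert i S) - card (insert i B)) = (-1) ^ (card S - card B)"
    and vec: "indicator_vec (insert i B) = axis i 1 + indicator_vec B"
    if "B \<in> Pow S" for B
  proof -
    have "i \<notin> B" using that assms by blast
    then show "(-1::real) ^ (card (insert i S) - card (insert i B)) = (-1) ^ (card S - card B)"
      using assms by simp
    from \<open>i \<notin> B\<close> show "indicator_vec (insert i B) = axis i 1 + indicator_vec B"
      by (auto simp: indicator_vec_def axis_def vec_eq_iff)
  qed
  have "Pow S \<inter> insert i ` Pow S = {}" using assms by auto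
  then have "shifted_difference a (insert i S) F =
      (\<Sum>B\<in>Pow S. (-1) ^ (card (insert i S) - card B) * F (a + indicator_vec B)) +
      (\<Sum>B\<in>insert i ` Pow S. (-1) ^ (card (insert i S) - card B) * F (a + indicator_vec B))"
    unfolding shifted_difference_def Pow_insert by (intro sum.union_disjoint) auto
  also have "(\<Sum>B\<in>insert i ` Pow S. (-1) ^ (card (insert i S) - card B) * F (a + indicator_vec B))
      = shifted_difference (a + axis i 1) S F"
    unfolding shifted_difference_def
    by (subst sum.reindex[OF inj]) (auto intro!: sum.cong simp: inserted vec add.assoc
        simp del: card_insert_disjoint card_insert_if)
  also have "(\<Sum>B\<in>Pow S. (-1) ^ (card (insert i S) - card B) * F (a + indicator_vec B))
      = - shifted_difference a S F"
    unfolding shifted_difference_def sum_negf[symmetric]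
    by (intro sum.cong) (simp_all add: omitted del: card_insert_disjoint card_insert_if)
  finally show ?thesis by simp
qed

lemma mem_unit_cube_iff: "u \<in> cbox 0 1 \<longleftrightarrow> (\<forall>j. 0 \<le> u $ j \<and> u $ j \<le> 1)"
  for u :: "real ^ 'p::finite"
  by (simp add: mem_box_cart)

text \<open>A continuous function on the compact cube is bounded, and a face has finite measure. The
  conditions on \<open>a\<close> keep the translated face inside the cube.\<close>

lemma integrable_on_face:
  fixes a :: "real ^ 'p::finite" and g :: "real ^ 'p \<Rightarrow> real"
  assumes cont: "continuous_on (cbox 0 1) g"
    and a: "a \<in> cbox 0 1" "\<And>j. j \<in> S \<Longrightarrow> a $ j = 0"
  shows "set_integrable (\<Pi>\<^sub>M i\<in>S. lborel) (S \<rightarrow>\<^sub>E {0..1}) (\<lambda>w. g (a + extend_zero S w))"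
proof -
  interpret product_sigma_finite "\<lambda>_::'p. lborel :: real measure" ..
  let ?M = "\<Pi>\<^sub>M i\<in>S. (lborel :: real measure)"
  let ?Q = "S \<rightarrow>\<^sub>E {0..1::real}"
  \<comment> \<open>Nothing is known of \<open>g\<close> outside the cube; cutting it off there makes it Borel measurable on the
    whole space without changing it on the face.\<close>
  define h where "h u = indicator (cbox 0 1) u *\<^sub>R g u" for u
  have face: "a + extend_zero S w \<in> cbox 0 1" if "w \<in> ?Q" for w
    using that a by (auto simp: mem_unit_cube_iff extend_zero_def PiE_iff)
  have [measurable]: "h \<in> borel_measurable borel"
    unfolding h_def by (intro borel_measurable_continuous_on_indicator cont) simp
  have "(\<lambda>w. extend_zero S w) = (\<lambda>w. \<Sum>j\<in>S. w j *\<^sub>R axis j 1)"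
    by (auto simp: extend_zero_def axis_def vec_eq_iff if_distrib cong: if_cong)
  then have [measurable]: "(\<lambda>w. extend_zero S w) \<in> borel_measurable ?M"
    by (auto intro!: borel_measurable_sum borel_measurable_scaleR borel_measurable_const
          measurable_component_singleton[where M = "\<lambda>_. lborel", simplified])
  have Q[measurable]: "?Q \<in> sets ?M" by (intro sets_PiM_I_finite) auto
  have "emeasure ?M ?Q = 1"
    by (subst emeasure_PiM) auto
  obtain C where C: "\<And>u. u \<in> cbox 0 1 \<Longrightarrow> norm (g u) \<le> C"
    using compact_imp_bounded[OF compact_continuous_image[OF cont compact_cbox]]
    by (auto simp: bounded_iff)
  have "integrable ?M (\<lambda>w. indicator ?Q w *\<^sub>R h (a + extend_zero S w))"
  proof (rule integrableI_bounded_set[where A = ?Q and B = C])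
    show "AE w in ?M. w \<in> ?Q \<longrightarrow> norm (indicator ?Q w *\<^sub>R h (a + extend_zero S w)) \<le> C"
      using face C by (intro AE_I2) (auto simp: h_def)
  qed (use \<open>emeasure ?M ?Q = 1\<close> in \<open>auto simp: indicator_def\<close>)
  moreover have "indicator ?Q w *\<^sub>R h (a + extend_zero S w) =
      indicator ?Q w *\<^sub>R g (a + extend_zero S w)" for w
    using face[of w] by (auto simp: h_def indicator_def)
  ultimately show ?thesis by (simp only: set_integrable_def)
qed

text \<open>Fubini's theorem for a face: a point of the larger face is a point of the smaller one moved by
  \<open>s\<close> in direction \<open>i\<close>.\<close>

lemma integral_face_insert:
  fixes a :: "real ^ 'p::finite" and g :: "real ^ 'p \<Rightarrow> real"
  assumes cont: "continuous_on (cbox 0 1) g" and "i \<notin> S"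
    and a: "a \<in> cbox 0 1" "\<And>j. j \<in> insert i S \<Longrightarrow> a $ j = 0"
  shows "(LINT w : insert i S \<rightarrow>\<^sub>E {0..1} | (\<Pi>\<^sub>M i\<in>insert i S. lborel).
      g (a + extend_zero (insert i S) w)) =
    (LINT w : S \<rightarrow>\<^sub>E {0..1} | (\<Pi>\<^sub>M i\<in>S. lborel).
      LINT s : {0..1} | lborel. g ((a + extend_zero S w) + s *\<^sub>R axis i 1))"
proof -
  interpret product_sigma_finite "\<lambda>_::'p. lborel :: real measure" ..
  have ind: "indicator (insert i S \<rightarrow>\<^sub>E {0..1}) (w(i := s)) =
      (indicator (S \<rightarrow>\<^sub>E {0..1}) w * indicator {0..1} s :: real)"
    if "w \<in> space (\<Pi>\<^sub>M i\<in>S. (lborel :: real measure))" for w s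
  proof -
    have "w \<in> extensional S" using that by (simp add: space_PiM PiE_def)
    \<comment> \<open>As \<open>w\<close> is extensional, its value at \<open>i\<close>, which the update overwrites, is \<open>undefined\<close>.\<close>
    then have "w(i := s) \<in> insert i S \<rightarrow>\<^sub>E {0..1} \<longleftrightarrow> w \<in> S \<rightarrow>\<^sub>E {0..1} \<and> s \<in> {0..1}"
      using \<open>i \<notin> S\<close> by (auto simp: PiE_iff extensional_def)
    then show ?thesis by (auto simp: indicator_def)
  qed
  have ext: "a + extend_zero (insert i S) (w(i := s)) = (a + extend_zero S w) + s *\<^sub>R axis i 1" for w s
    using \<open>i \<notin> S\<close> by (auto simp: extend_zero_def axis_def vec_eq_iff)
  show ?thesis
    unfolding set_lebesgue_integral_def
    by (subst product_integral_insert)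
      (use \<open>i \<notin> S\<close> integrable_on_face[OF cont a] in
        \<open>auto simp: ind ext set_integrable_def mult.assoc
           intro!: Bochner_Integration.integral_cong\<close>)
qed

text \<open>The head of the list is differentiated last, so the induction hypothesis speaks of the function
  \<open>g\<close> to which the derivative in direction \<open>i\<close> is still to be applied. It is used at the two base
  points \<open>a\<close> and \<open>a + axis i 1\<close>.\<close>

lemma shifted_difference_eq_integral:
  fixes U :: "(real ^ 'p::finite) set"
  assumes "open U" and cube: "cbox 0 1 \<subseteq> U"
    and "C_on (length ts) U F" and "distinct ts"
    and "a \<in> cbox 0 1" and "\<And>j. j \<in> set ts \<Longrightarrow> a $ j = 0"
  shows "shifted_difference a (set ts) F =
    (LINT w : set ts \<rightarrow>\<^sub>E {0..1} | (\<Pi>\<^sub>M i\<in>set ts. lborel).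
       iterated_partial ts F (a + extend_zero (set ts) w))"
  using assms(3-6)
proof (induction ts arbitrary: a)
  case Nil
  have "indicator_vec {} = (0 :: real ^ 'p)"
    and "extend_zero {} w = (0 :: real ^ 'p)" for w
    by (simp_all add: indicator_vec_def extend_zero_def vec_eq_iff)
  then show ?case
    by (simp add: shifted_difference_def set_lebesgue_integral_def PiM_empty
        lebesgue_integral_count_space_finite)
next
  case (Cons i ts)
  define S where "S = set ts"
  define g where "g = iterated_partial ts F"
  let ?M = "\<Pi>\<^sub>M i\<in>S. (lborel :: real measure)"
  let ?Q = "S \<rightarrow>\<^sub>E {0..1::real}"
  have "i \<notin> S" using Cons.prems by (simp add: S_def)
  have F: "C_on (length ts) U F" by (rule C_on_SucD) (use Cons.prems(1) in simp)
  have g1: "C_on (Suc 0) U g"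
    unfolding g_def using Cons.prems(1) by (intro C_on_iterated_partial) simp
  have cont_g: "continuous_on (cbox 0 1) g"
    using C_on_imp_continuous[OF g1] cube by (rule continuous_on_subset)
  have cont_dg: "continuous_on (cbox 0 1) (partial_deriv i g)"
    using g1 cube by (auto intro: continuous_on_subset)
  have a: "a \<in> cbox 0 1" "\<And>j. j \<in> S \<Longrightarrow> a $ j = 0" and "a $ i = 0"
    using Cons.prems by (auto simp: S_def)
  then have a': "a + axis i 1 \<in> cbox 0 1" "\<And>j. j \<in> S \<Longrightarrow> (a + axis i 1) $ j = 0"
    using \<open>i \<notin> S\<close> by (auto simp: mem_unit_cube_iff axis_def)
  have seg: "(a + extend_zero S w) + s *\<^sub>R axis i 1 \<in> U" if "w \<in> ?Q" "s \<in> {0..1}" for w s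
  proof -
    have "(a + extend_zero S w) + s *\<^sub>R axis i 1 \<in> cbox 0 1"
      using that a \<open>a $ i = 0\<close> \<open>i \<notin> S\<close>
      by (auto simp: mem_unit_cube_iff extend_zero_def axis_def PiE_iff)
    then show ?thesis using cube by blast
  qed
  have "shifted_difference a (set (i # ts)) F =
      shifted_difference (a + axis i 1) S F - shifted_difference a S F"
    using \<open>i \<notin> S\<close> by (simp add: shifted_difference_insert S_def)
  also have "\<dots> = (LINT w : ?Q | ?M. g ((a + axis i 1) + extend_zero S w)) -
      (LINT w : ?Q | ?M. g (a + extend_zero S w))"
    using Cons.IH[of a] Cons.IH[of "a + axis i 1"] F Cons.prems a a' by (simp add: S_def g_def)
  also have "\<dots> = (LINT w : ?Q | ?M.
      g ((a + axis i 1) + extend_zero S w) - g (a + extend_zero S w))"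
    using cont_g a a' by (intro set_integral_diff(2)[symmetric] integrable_on_face)
  also have "\<dots> = (LINT w : ?Q | ?M.
      LINT s : {0..1} | lborel. partial_deriv i g ((a + extend_zero S w) + s *\<^sub>R axis i 1))"
    unfolding set_lebesgue_integral_def[of ?M]
  proof (intro Bochner_Integration.integral_cong refl)
    fix w
    show "indicator ?Q w *\<^sub>R (g ((a + axis i 1) + extend_zero S w) - g (a + extend_zero S w)) =
      indicator ?Q w *\<^sub>R
        (LINT s : {0..1} | lborel. partial_deriv i g ((a + extend_zero S w) + s *\<^sub>R axis i 1))"
    proof (cases "w \<in> ?Q")
      case True
      then have "(LINT s : {0..1} | lborel.
            partial_deriv i g ((a + extend_zero S w) + s *\<^sub>R axis i 1)) =
          g ((a + extend_zero S w) + axis i 1) - g (a + extend_zero S w)"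
        using \<open>open U\<close> g1 seg by (intro integral_partial_deriv)
      then show ?thesis by (simp add: add_ac)
    qed simp
  qed
  also have "\<dots> = (LINT w : insert i S \<rightarrow>\<^sub>E {0..1} | (\<Pi>\<^sub>M i\<in>insert i S. lborel).
      partial_deriv i g (a + extend_zero (insert i S) w))"
    using a \<open>a $ i = 0\<close> \<open>i \<notin> S\<close> cont_dg by (intro integral_face_insert[symmetric]) auto
  finally show ?case by (simp add: S_def g_def)
qed

theorem corollary4:
  fixes U :: "(real ^ 'p::finite) set"
    and E0 :: "'y \<Rightarrow> 's \<Rightarrow> real"
    and \<Delta> :: "'p \<Rightarrow> 'y \<Rightarrow> 's \<Rightarrow> real"
    and y :: 'y
    and T :: "'p set"
    and ts :: "'p list"
  assumes "open U" and "cbox 0 1 \<subseteq> U"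
    and "\<forall>u\<in>U. bdd_below (range (\<lambda>\<sigma>. energy E0 \<Delta> y \<sigma> u))"
    and "C_on (card T) U (reduced_energy E0 \<Delta> y)"
    and "distinct ts" and "set ts = T"
  shows "mixed_difference T (reduced_energy E0 \<Delta> y) =
    (LINT w : (T \<rightarrow>\<^sub>E {0..1}) | (\<Pi>\<^sub>M i\<in>T. lborel).
       iterated_partial ts (reduced_energy E0 \<Delta> y) (extend_zero T w))"
proof -
  have "card T = length ts"
    using assms(5,6) distinct_card by blast
  then show ?thesis
    using shifted_difference_eq_integral[of U ts "reduced_energy E0 \<Delta> y" 0] assms
    by (simp add: shifted_difference_def mixed_difference_def mem_unit_cube_iff)
qed

end
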